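(* Let $m_1,m_2>0$ with $2m_1+m_2=3$ and $E<0$, let $\gamma$ be Broucke's $T$-periodic orbit of the Hamiltonian system with Hamiltonian $\Gamma$, let $Y_0$ be the explicit $8\times 8$ matrix given in the context, and let $K$ be the $4\times4$ matrix associated with $\gamma$ and $Y_0$ as in the context. Then $K\in\mathcal{M}$, i.e. $K$ has the form $$K=\begin{bmatrix} k_{11}&0&0&k_{14}\\0&k_{22}&k_{23}&0\\0&k_{32}&k_{33}&0\\k_{41}&0&0&k_{44}\end{bmatrix}.$$
   Context: Coordinates are $z=(Q_1,Q_2,Q_3,Q_4,P_1,P_2,P_3,P_4)\in\mathbb{R}^8$. Put $\mu=\frac12+\frac{m_1}{m_2}$ and $\mathbf{Q}=(Q_1^2-Q_2^2)Q_3+2Q_1Q_2Q_4$. The regularized Hamiltonian is $$\Gamma=\frac{P_1^2+P_2^2}{4m_1}+(P_3^2+P_4^2)(Q_1^2+Q_2^2)\left(\frac1{m_1}+\frac2{m_2}\right)-\frac{m_1m_2(Q_1^2+Q_2^2)}{\sqrt{\frac14(Q_1^2+Q_2^2)^2+\mu\mathbf{Q}+\mu^2(Q_3^2+Q_4^2)}}-\frac{m_1m_2(Q_1^2+Q_2^2)}{\sqrt{\frac14(Q_1^2+Q_2^2)^2-\mu\mathbf{Q}+\mu^2(Q_3^2+Q_4^2)}}-m_1^2-E(Q_1^2+Q_2^2),$$ defined where both radicands are positive. The Hamiltonian system is $z'=J\nabla\Gamma(z)$, $'=d/ds$, with $J=\begin{bmatrix}O&I\\-I&O\end{bmatrix}$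 ($4\times4$ blocks). Broucke's orbit $\gamma$ is a $T$-periodic solution with $\gamma(0)=(0,0,0,\zeta_4,2m_1^{3/2},0,0,0)$ and $\gamma(T/4)=(\zeta_1,0,0,0,0,0,0,\zeta_8)$ for some nonzero real $\zeta_1,\zeta_4,\zeta_8$. It satisfies $\gamma(s)=-S\gamma(T/2-s)=S\gamma(T-s)$ for all $s$, where $S=\operatorname{diag}(-1,1,-1,1,1,-1,1,-1)$, and it satisfies $Q_2=Q_3=P_2=P_3=0$ for all $s$. Let $e_1,\dots,e_8$ be the standard basis of $\mathbb{R}^8$. $Y_0$ is the (orthogonal and symplectic) matrix whose columns, in order, are $-e_5,\,-e_7,\,e_2,\,e_4,\,e_1,\,e_3,\,e_6,\,e_8$. It satisfies $-Y_0^{-1}SY_0=\operatorname{diag}(-I,I)$ ($4\times 4$ blocks). Let $Y(s)$ be the matrix solution of $\xi'=JD^2\Gamma(\gamma(s))\xi$, $\xi(0)=Y_0$, where $D^2\Gamma$ is the Hessian. Set $B=Y(T/4)$ and $W=Y_0^{-1}SY_0B^{-1}SB$. Then $W$ is symplectic and there are $4\times4$ matrices $K,L_1,L_2$ with $$W=\begin{bmatrix}K^T&L_1\\L_2&K\end{bmatrix},\qquad \tfrac12(W+W^{-1})=\begin{bmatrix}K^T&0\\0&K\end{bmatrix};$$ this defines $K$ (the lower-right $4\times4$ block of $W$). $\mathcal{M}$ is the set of real $4\times4$ matrices whose $(1,2),(1,3),(2,1),(2,4),(3,1),(3,4),(4,2),(4,3)$ entries are all zero. *)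

theory Defs
  imports "HOL-Analysis.Analysis"
begin

text \<open>
  Phase space is \<open>real^8\<close> with coordinates \<open>(Q1,Q2,Q3,Q4,P1,P2,P3,P4)\<close> at the indices \<open>1,\<dots>,8\<close>.
  In the numeral type \<open>8\<close> the index \<open>8\<close> is the same element as \<open>0\<close>; the eight indices
  \<open>1,\<dots>,8\<close> are still distinct and exhaust the type, and \<open>vector [x1,\<dots>,x8]\<close> puts \<open>x8\<close> there.
\<close>

definition gradient :: "(real^'n \<Rightarrow> real) \<Rightarrow> real^'n \<Rightarrow> real^'n" where
  "gradient f x = (\<chi> i. frechet_derivative f (at x) (axis i 1))"

definition hessian :: "(real^'n \<Rightarrow> real) \<Rightarrow> real^'n \<Rightarrow> real^'n^'n" where
  "hessian f x = jacobian (gradient f) (at x)"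

definition diag_mat :: "real^'n \<Rightarrow> real^'n^'n" where
  "diag_mat d = (\<chi> i j. if i = j then d $ i else 0)"

text \<open>In an iterated \<open>vector\<close>, the inner vectors are the rows.\<close>

definition Jmat :: "real^8^8" where
  "Jmat = vector
    [vector [ 0, 0, 0, 0, 1, 0, 0, 0],
     vector [ 0, 0, 0, 0, 0, 1, 0, 0],
     vector [ 0, 0, 0, 0, 0, 0, 1, 0],
     vector [ 0, 0, 0, 0, 0, 0, 0, 1],
     vector [-1, 0, 0, 0, 0, 0, 0, 0],
     vector [ 0,-1, 0, 0, 0, 0, 0, 0],
     vector [ 0, 0,-1, 0, 0, 0, 0, 0],
     vector [ 0, 0, 0,-1, 0, 0, 0, 0]]"

definition Smat :: "real^8^8" where
  "Smat = diag_mat (vector [-1, 1, -1, 1, 1, -1, 1, -1])"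

text \<open>The transpose turns the listed vectors into columns.\<close>

definition Y0mat :: "real^8^8" where
  "Y0mat = transpose (vector
    [- axis 5 1, - axis 7 1, axis 2 1, axis 4 1, axis 1 1, axis 3 1, axis 6 1, axis 8 1])"

definition lower_right_block :: "real^8^8 \<Rightarrow> real^4^4" where
  "lower_right_block A = vector
    [vector [A$5$5, A$5$6, A$5$7, A$5$8],
     vector [A$6$5, A$6$6, A$6$7, A$6$8],
     vector [A$7$5, A$7$6, A$7$7, A$7$8],
     vector [A$8$5, A$8$6, A$8$7, A$8$8]]"

definition Wmat :: "real^8^8 \<Rightarrow> real^8^8" where
  "Wmat B = matrix_inv Y0mat ** Smat ** Y0mat ** matrix_inv B ** Smat ** B"

definition Kmat :: "real^8^8 \<Rightarrow> real^4^4" where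
  "Kmat B = lower_right_block (Wmat B)"

definition Mset :: "(real^4^4) set" where
  "Mset = {K. K$1$2 = 0 \<and> K$1$3 = 0 \<and> K$2$1 = 0 \<and> K$2$4 = 0 \<and>
              K$3$1 = 0 \<and> K$3$4 = 0 \<and> K$4$2 = 0 \<and> K$4$3 = 0}"

definition boldQ :: "real^8 \<Rightarrow> real" where
  "boldQ z = ((z$1)\<^sup>2 - (z$2)\<^sup>2) * z$3 + 2 * z$1 * z$2 * z$4"

definition mass_mu :: "real \<Rightarrow> real \<Rightarrow> real" where
  "mass_mu m1 m2 = 1/2 + m1 / m2"

definition radicand_plus :: "real \<Rightarrow> real \<Rightarrow> real^8 \<Rightarrow> real" where
  "radicand_plus m1 m2 z = 1/4 * ((z$1)\<^sup>2 + (z$2)\<^sup>2)\<^sup>2 + mass_mu m1 m2 * boldQ z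
     + (mass_mu m1 m2)\<^sup>2 * ((z$3)\<^sup>2 + (z$4)\<^sup>2)"

definition radicand_minus :: "real \<Rightarrow> real \<Rightarrow> real^8 \<Rightarrow> real" where
  "radicand_minus m1 m2 z = 1/4 * ((z$1)\<^sup>2 + (z$2)\<^sup>2)\<^sup>2 - mass_mu m1 m2 * boldQ z
     + (mass_mu m1 m2)\<^sup>2 * ((z$3)\<^sup>2 + (z$4)\<^sup>2)"

definition Gam_domain :: "real \<Rightarrow> real \<Rightarrow> (real^8) set" where
  "Gam_domain m1 m2 = {z. radicand_plus m1 m2 z > 0 \<and> radicand_minus m1 m2 z > 0}"

text \<open>Only the values on the open set \<open>Gam_domain m1 m2\<close> are meaningful.\<close>

definition Gam :: "real \<Rightarrow> real \<Rightarrow> real \<Rightarrow> real^8 \<Rightarrow> real" where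
  "Gam m1 m2 E z =
     ((z$5)\<^sup>2 + (z$6)\<^sup>2) / (4 * m1)
     + ((z$7)\<^sup>2 + (z$8)\<^sup>2) * ((z$1)\<^sup>2 + (z$2)\<^sup>2) * (1 / m1 + 2 / m2)
     - m1 * m2 * ((z$1)\<^sup>2 + (z$2)\<^sup>2) / sqrt (radicand_plus m1 m2 z)
     - m1 * m2 * ((z$1)\<^sup>2 + (z$2)\<^sup>2) / sqrt (radicand_minus m1 m2 z)
     - m1\<^sup>2 - E * ((z$1)\<^sup>2 + (z$2)\<^sup>2)"

definition Gam_solution :: "real \<Rightarrow> real \<Rightarrow> real \<Rightarrow> (real \<Rightarrow> real^8) \<Rightarrow> bool" where
  "Gam_solution m1 m2 E \<gamma> \<longleftrightarrow>
     (\<forall>s. \<gamma> s \<in> Gam_domain m1 m2 \<and>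
          (\<gamma> has_vector_derivative (Jmat *v gradient (Gam m1 m2 E) (\<gamma> s))) (at s))"

definition broucke_orbit :: "real \<Rightarrow> real \<Rightarrow> real \<Rightarrow> real \<Rightarrow> (real \<Rightarrow> real^8) \<Rightarrow> bool" where
  "broucke_orbit m1 m2 E T \<gamma> \<longleftrightarrow>
     T > 0 \<and> (\<forall>s. \<gamma> (s + T) = \<gamma> s) \<and>
     Gam_solution m1 m2 E \<gamma> \<and>
     (\<exists>\<zeta>1 \<zeta>4 \<zeta>8. \<zeta>1 \<noteq> 0 \<and> \<zeta>4 \<noteq> 0 \<and> \<zeta>8 \<noteq> 0 \<and>
        \<gamma> 0 = vector [0, 0, 0, \<zeta>4, 2 * m1 powr (3/2), 0, 0, 0] \<and>
        \<gamma> (T/4) = vector [\<zeta>1, 0, 0, 0, 0, 0, 0, \<zeta>8]) \<and>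
     (\<forall>s. \<gamma> s = - (Smat *v \<gamma> (T/2 - s)) \<and> \<gamma> s = Smat *v \<gamma> (T - s)) \<and>
     (\<forall>s. \<gamma> s $ 2 = 0 \<and> \<gamma> s $ 3 = 0 \<and> \<gamma> s $ 6 = 0 \<and> \<gamma> s $ 7 = 0)"

definition linearized_solution ::
  "real \<Rightarrow> real \<Rightarrow> real \<Rightarrow> (real \<Rightarrow> real^8) \<Rightarrow> (real \<Rightarrow> real^8^8) \<Rightarrow> bool" where
  "linearized_solution m1 m2 E \<gamma> Y \<longleftrightarrow>
     Y 0 = Y0mat \<and>
     (\<forall>s. (Y has_vector_derivative (Jmat ** hessian (Gam m1 m2 E) (\<gamma> s) ** Y s)) (at s))"

end

theory Submission
  imports Defs
begin

text \<open>
  The zero pattern of \<open>K\<close> comes from a symmetry. Let \<open>R\<close> be the diagonal matrix with signs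
  \<open>(1,-1,-1,1,1,-1,-1,1)\<close> (called \<open>reflection\<close> below). It changes the sign of \<open>boldQ\<close>, so it
  exchanges the two radicands and leaves \<open>Gam\<close> invariant (\<open>reflection_Gam\<close>). The coordinates that
  it negates are exactly \<open>Q2, Q3, P2, P3\<close>, which vanish along the orbit, so \<open>R\<close> fixes the orbit
  pointwise. Differentiating the invariance twice at a fixed point shows that \<open>R\<close> commutes with
  the Hessian there (\<open>hessian_commutes_with_symmetry\<close>).

  As \<open>R\<close> also commutes with \<open>J\<close>, both \<open>R Y(s)\<close> and \<open>Y(s) R\<close> solve the linearized equation. The
  columns of \<open>Y0\<close> are, up to sign, basis vectors ordered so that \<open>R Y0 = Y0 R\<close>; so the two
  solutions start at the same matrix and coincide by uniqueness
  (\<open>fundamental_matrix_commutes\<close>). Uniqueness also makes \<open>B = Y(T/4)\<close> invertible, and then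
  \<open>B\<inverse>\<close> commutes with \<open>R\<close> too. Every factor of \<open>W = Y0\<inverse> S Y0 B\<inverse> S B\<close> thus commutes with
  \<open>R\<close>. A matrix commuting with a diagonal matrix vanishes at the entries whose row and column
  carry different diagonal values. The last four signs of \<open>R\<close> are \<open>(1,-1,-1,1)\<close>, and for the
  lower-right block of \<open>W\<close> this gives the eight zeros that define \<open>Mset\<close>.

  The argument uses that \<open>Gam\<close> is twice continuously differentiable on its domain: the derivatives
  must exist for \<open>gradient\<close> and \<open>hessian\<close> to be meaningful, and continuity of the Hessian along
  the orbit gives the bound on which uniqueness rests. No derivative of \<open>Gam\<close> is computed; \<open>Gam\<close>
  belongs to a class of functions that is closed under taking partial derivatives.
\<close>

section \<open>A class of functions closed under partial derivatives\<close>

text \<open>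
  The class consists of what polynomials and reciprocal square roots of positive members generate.
  A partial derivative of \<open>f\<^bsup>-1/2\<^esup>\<close> is \<open>- 1/2 (f\<^bsup>-1/2\<^esup>)\<^sup>3\<close> times that of \<open>f\<close>, hence again a member.
  Positivity keeps the square root away from its singularity at \<open>0\<close>.
\<close>

inductive elementary_on :: "(real^'n) set \<Rightarrow> (real^'n \<Rightarrow> real) \<Rightarrow> bool"
  for D :: "(real^'n) set" where
  const: "elementary_on D (\<lambda>z. c)"
| coord: "elementary_on D (\<lambda>z. z $ i)"
| add: "elementary_on D f \<Longrightarrow> elementary_on D g \<Longrightarrow> elementary_on D (\<lambda>z. f z + g z)"
| mult: "elementary_on D f \<Longrightarrow> elementary_on D g \<Longrightarrow> elementary_on D (\<lambda>z. f z * g z)"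
| inverse_sqrt: "elementary_on D f \<Longrightarrow> (\<And>z. z \<in> D \<Longrightarrow> f z > 0)
    \<Longrightarrow> elementary_on D (\<lambda>z. inverse (sqrt (f z)))"

lemma elementary_on_diff:
  assumes "elementary_on D f" "elementary_on D g"
  shows "elementary_on D (\<lambda>z. f z - g z)"
  using elementary_on.add[OF assms(1) elementary_on.mult[OF elementary_on.const[of D "-1"] assms(2)]]
  by simp

lemma elementary_on_power:
  assumes "elementary_on D f"
  shows "elementary_on D (\<lambda>z. f z ^ n)"
  by (induction n) (auto intro: elementary_on.intros assms)

lemma elementary_on_imp_partials:
  fixes f :: "real^'n \<Rightarrow> real"
  assumes "elementary_on D f"
  shows "\<exists>g. (\<forall>i. elementary_on D (g i)) \<and>
    (\<forall>z\<in>D. (f has_derivative (\<lambda>h. \<Sum>i\<in>UNIV. g i z * h $ i)) (at z))"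
  using assms
proof (induction rule: elementary_on.induct)
  case (const c)
  then show ?case
    by (intro exI[of _ "\<lambda>i z. 0"]) (auto intro: elementary_on.const)
next
  case (coord k)
  have "((\<lambda>z::real^'n. z $ k) has_derivative (\<lambda>h. h $ k)) (at z)" for z
    by (intro bounded_linear_imp_has_derivative bounded_linear_vec_nth)
  moreover have "(\<Sum>i\<in>UNIV. (if i = k then 1 else 0) * h $ i) = h $ k" for h :: "real^'n"
    by (simp add: if_distrib[of "\<lambda>x. x * _"] cong: if_cong)
  ultimately show ?case
    by (intro exI[of _ "\<lambda>i z. if i = k then 1 else 0"]) (auto intro: elementary_on.const)
next
  case (add f g)
  then obtain f' g' where
    f': "\<And>i. elementary_on D (f' i)"
        "\<And>z. z \<in> D \<Longrightarrow> (f has_derivative (\<lambda>h. \<Sum>i\<in>UNIV. f' i z * h $ i)) (at z)" and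
    g': "\<And>i. elementary_on D (g' i)"
        "\<And>z. z \<in> D \<Longrightarrow> (g has_derivative (\<lambda>h. \<Sum>i\<in>UNIV. g' i z * h $ i)) (at z)"
    by blast
  have "((\<lambda>z. f z + g z) has_derivative (\<lambda>h. \<Sum>i\<in>UNIV. (f' i z + g' i z) * h $ i)) (at z)"
    if "z \<in> D" for z
    using has_derivative_add[OF f'(2)[OF that] g'(2)[OF that]]
    by (simp add: sum.distrib algebra_simps)
  then show ?case
    by (intro exI[of _ "\<lambda>i z. f' i z + g' i z"]) (auto intro: elementary_on.add f' g')
next
  case (mult f g)
  then obtain f' g' where
    f': "\<And>i. elementary_on D (f' i)"
        "\<And>z. z \<in> D \<Longrightarrow> (f has_derivative (\<lambda>h. \<Sum>i\<in>UNIV. f' i z * h $ i)) (at z)" and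
    g': "\<And>i. elementary_on D (g' i)"
        "\<And>z. z \<in> D \<Longrightarrow> (g has_derivative (\<lambda>h. \<Sum>i\<in>UNIV. g' i z * h $ i)) (at z)"
    by blast
  have "((\<lambda>z. f z * g z) has_derivative
      (\<lambda>h. \<Sum>i\<in>UNIV. (f z * g' i z + f' i z * g z) * h $ i)) (at z)"
    if "z \<in> D" for z
    using has_derivative_mult[OF f'(2)[OF that] g'(2)[OF that]]
    by (simp add: sum.distrib algebra_simps sum_distrib_left)
  then show ?case
    by (intro exI[of _ "\<lambda>i z. f z * g' i z + f' i z * g z"])
       (auto intro!: elementary_on.add elementary_on.mult f' g' mult.hyps)
next
  case (inverse_sqrt f)
  then obtain f' where
    f': "\<And>i. elementary_on D (f' i)"
        "\<And>z. z \<in> D \<Longrightarrow> (f has_derivative (\<lambda>h. \<Sum>i\<in>UNIV. f' i z * h $ i)) (at z)"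
    by blast
  define c where "c z = - 1/2 * inverse (sqrt (f z)) ^ 3" for z
  have "((\<lambda>z. inverse (sqrt (f z))) has_derivative (\<lambda>h. \<Sum>i\<in>UNIV. (c z * f' i z) * h $ i)) (at z)"
    if z: "z \<in> D" for z
  proof -
    have pos: "f z > 0" using inverse_sqrt.hyps(2)[OF z] .
    have "((\<lambda>t. inverse (sqrt t)) has_field_derivative c z) (at (f z))"
      unfolding c_def using pos
      by (auto intro!: derivative_eq_intros simp: field_simps power2_eq_square power3_eq_cube)
    then have "((\<lambda>z. inverse (sqrt (f z))) has_derivative
        (\<lambda>h. c z * (\<Sum>i\<in>UNIV. f' i z * h $ i))) (at z)"
      using has_derivative_compose[OF f'(2)[OF z]] unfolding has_field_derivative_def by blast
    then show ?thesis by (simp add: sum_distrib_left mult.assoc)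
  qed
  moreover have "elementary_on D (\<lambda>z. c z * f' i z)" for i
    unfolding c_def
    by (intro elementary_on.mult elementary_on_power elementary_on.inverse_sqrt
        elementary_on.const f' inverse_sqrt.hyps)
  ultimately show ?case
    by (intro exI[of _ "\<lambda>i z. c z * f' i z"]) auto
qed

lemma elementary_on_imp_continuous_on:
  assumes "elementary_on D f"
  shows "continuous_on D f"
  using assms
  by (induction rule: elementary_on.induct) (auto intro!: continuous_intros, fastforce)

text \<open>
  The partial derivatives are again elementary, so a second application differentiates them; the
  entries of the Hessian are elementary in turn, hence continuous. Openness of \<open>D\<close> matters because
  \<open>gradient f\<close> agrees with the vector of elementary partial derivatives only on \<open>D\<close>.
\<close>

lemma elementary_on_imp_C2:
  fixes f :: "real^'n \<Rightarrow> real"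
  assumes "open D" and "elementary_on D f"
  shows "z \<in> D \<Longrightarrow> f differentiable (at z)"
    and "z \<in> D \<Longrightarrow> (gradient f has_derivative (\<lambda>h. hessian f z *v h)) (at z)"
    and "continuous_on D (hessian f)"
proof -
  obtain g where g: "\<And>i. elementary_on D (g i)"
    "\<And>z. z \<in> D \<Longrightarrow> (f has_derivative (\<lambda>h. \<Sum>i\<in>UNIV. g i z * h $ i)) (at z)"
    using elementary_on_imp_partials[OF assms(2)] by blast
  have "\<forall>i. \<exists>g'. (\<forall>j. elementary_on D (g' j)) \<and>
    (\<forall>z\<in>D. (g i has_derivative (\<lambda>h. \<Sum>j\<in>UNIV. g' j z * h $ j)) (at z))"
    using elementary_on_imp_partials[OF g(1)] by blast
  then obtain g' where g': "\<And>i j. elementary_on D (g' i j)"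
    "\<And>i z. z \<in> D \<Longrightarrow> (g i has_derivative (\<lambda>h. \<Sum>j\<in>UNIV. g' i j z * h $ j)) (at z)"
    by metis
  show "f differentiable (at z)" if "z \<in> D" for z
    using g(2)[OF that] unfolding differentiable_def by blast
  have grad: "gradient f z = (\<chi> i. g i z)" if "z \<in> D" for z
    unfolding gradient_def frechet_derivative_at[OF g(2)[OF that], symmetric]
    by (simp add: axis_def if_distrib[of "\<lambda>x. _ * x"] cong: if_cong)
  have *: "(gradient f has_derivative (\<lambda>h. (\<chi> i j. g' i j z) *v h)) (at z)" if "z \<in> D" for z
  proof -
    have "((\<lambda>z. \<chi> i. g i z) has_derivative (\<lambda>h. \<chi> i. \<Sum>j\<in>UNIV. g' i j z * h $ j)) (at z)"
      using g'(2)[OF that]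
      by (subst has_derivative_componentwise_within)
         (auto simp: Basis_vec_def inner_axis)
    then have "((\<lambda>z. \<chi> i. g i z) has_derivative (\<lambda>h. (\<chi> i j. g' i j z) *v h)) (at z)"
      by (simp add: matrix_vector_mult_def)
    then show ?thesis
      by (rule has_derivative_transform_within_open[OF _ assms(1) that]) (simp add: grad)
  qed
  have hess: "hessian f z = (\<chi> i j. g' i j z)" if "z \<in> D" for z
    unfolding hessian_def jacobian_def frechet_derivative_at[OF *[OF that], symmetric]
    by (rule matrix_of_matrix_vector_mul)
  show "(gradient f has_derivative (\<lambda>h. hessian f z *v h)) (at z)" if "z \<in> D" for z
    using *[OF that] hess[OF that] by simp
  have "continuous_on D (\<lambda>z. \<chi> i j. g' i j z)"
    by (intro continuous_on_vec_lambda elementary_on_imp_continuous_on g')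
  then show "continuous_on D (hessian f)"
    using hess by (simp cong: continuous_on_cong)
qed

section \<open>Diagonal symmetries of a function and its Hessian\<close>

lemma diag_mat_mult_nth [simp]: "(diag_mat d ** M) $ i $ j = d $ i * M $ i $ j"
  by (simp add: diag_mat_def matrix_matrix_mult_def if_distrib[of "\<lambda>x. x * _"] cong: if_cong)

lemma mult_diag_mat_nth [simp]: "(M ** diag_mat d) $ i $ j = M $ i $ j * d $ j"
  by (simp add: diag_mat_def matrix_matrix_mult_def if_distrib[of "\<lambda>x. _ * x"] cong: if_cong)

lemma diag_mat_vector_nth [simp]: "(diag_mat d *v v) $ i = d $ i * v $ i"
  by (simp add: diag_mat_def matrix_vector_mult_def if_distrib[of "\<lambda>x. x * _"] cong: if_cong)

lemma commute_diag_mat_imp_zero: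
  assumes "diag_mat d ** M = M ** diag_mat d" and "d $ i \<noteq> d $ j"
  shows "M $ i $ j = 0"
proof -
  have "d $ i * M $ i $ j = M $ i $ j * d $ j"
    using assms(1) by (metis diag_mat_mult_nth mult_diag_mat_nth)
  then show ?thesis using assms(2) by (simp add: mult.commute)
qed

text \<open>
  The converse of the preceding lemma: it reduces a commutation to inspecting the nonzero entries of
  a concrete matrix.
\<close>

lemma commute_diag_matI:
  assumes "\<And>i j. M $ i $ j = 0 \<or> d $ i = d $ j"
  shows "diag_mat d ** M = M ** diag_mat d"
  using assms by (fastforce simp: vec_eq_iff)

text \<open>
  The chain rule applied to \<open>f = f \<circ> R\<close> gives \<open>\<nabla>f(v) = R \<nabla>f(R v)\<close> on \<open>D\<close>, since the diagonal
  matrix \<open>R\<close> is its own transpose. Differentiating again at the fixed point \<open>z\<close> gives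
  \<open>H = R H R\<close>, and \<open>R\<close> is an involution.
\<close>

lemma hessian_commutes_with_symmetry:
  fixes f :: "real^'n \<Rightarrow> real" and d :: "real^'n"
  defines "R \<equiv> diag_mat d"
  assumes D: "open D" "elementary_on D f"
    and sq: "\<And>i. d $ i * d $ i = 1"
    and inv: "\<And>v. f (R *v v) = f v" "\<And>v. v \<in> D \<Longrightarrow> R *v v \<in> D"
    and z: "z \<in> D" "R *v z = z"
  shows "R ** hessian f z = hessian f z ** R"
proof -
  have lin: "((*v) R has_derivative (*v) R) (at v)" for v
    by (intro bounded_linear_imp_has_derivative) simp
  have grad: "gradient f v = R *v gradient f (R *v v)" if v: "v \<in> D" for v
  proof -
    have "(f has_derivative frechet_derivative f (at (R *v v))) (at (R *v v))"
      using elementary_on_imp_C2(1)[OF D inv(2)[OF v]] frechet_derivative_works by blast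
    from has_derivative_compose[OF lin this]
    have "(f has_derivative (\<lambda>h. frechet_derivative f (at (R *v v)) (R *v h))) (at v)"
      by (simp add: inv)
    then have "frechet_derivative f (at v) = (\<lambda>h. frechet_derivative f (at (R *v v)) (R *v h))"
      using frechet_derivative_at by metis
    moreover have "R *v axis i 1 = d $ i *\<^sub>R axis i 1" for i
      unfolding R_def vec_eq_iff by (auto simp: axis_def)
    moreover have "linear (frechet_derivative f (at (R *v v)))"
      using elementary_on_imp_C2(1)[OF D inv(2)[OF v]] by (rule linear_frechet_derivative)
    ultimately have "gradient f v $ i = d $ i * gradient f (R *v v) $ i" for i
      by (simp only: gradient_def vec_lambda_beta linear_cmul real_scaleR_def)
    then show ?thesis by (simp add: vec_eq_iff R_def)
  qed
  have "(gradient f has_derivative (*v) (hessian f z)) (at (R *v z))"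
    using elementary_on_imp_C2(2)[OF D z(1)] z(2) by simp
  from has_derivative_compose[OF has_derivative_compose[OF lin this] lin]
  have "((\<lambda>v. R *v gradient f (R *v v)) has_derivative
      (\<lambda>h. R *v (hessian f z *v (R *v h)))) (at z)" .
  then have "(gradient f has_derivative (\<lambda>h. R *v (hessian f z *v (R *v h)))) (at z)"
    by (rule has_derivative_transform_within_open[OF _ D(1) z(1)]) (rule grad[symmetric])
  then have "(\<lambda>h. R *v (hessian f z *v (R *v h))) = (\<lambda>h. hessian f z *v h)"
    using elementary_on_imp_C2(2)[OF D z(1)] has_derivative_unique by blast
  then have "R ** hessian f z ** R = hessian f z"
    by (metis matrix_eq matrix_vector_mul_assoc)
  moreover have "R ** R = mat 1"
    using sq by (auto simp: vec_eq_iff R_def mat_def) (auto simp: diag_mat_def)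
  ultimately show ?thesis
    by (metis matrix_mul_assoc matrix_mul_rid)
qed

section \<open>Uniqueness for linear differential equations\<close>

text \<open>
  With \<open>C\<close> a bound on the operator norms of \<open>A\<close>, the function \<open>N = |x|\<^sup>2\<close> satisfies
  \<open>|N'| \<le> 2 C N\<close>. Hence \<open>exp (-2 C s) N s\<close> is nonincreasing and \<open>exp (2 C s) N s\<close> is
  nondecreasing: the first carries a zero of \<open>N\<close> forward in time, the second backward. The
  forward direction gives commutation below, the backward direction invertibility.
\<close>

lemma linear_ode_zero:
  fixes x :: "real \<Rightarrow> real^'n" and A :: "real \<Rightarrow> real^'n^'n"
  assumes cont: "continuous_on {a..b} A"
    and ode: "\<And>s. (x has_vector_derivative (A s *v x s)) (at s)"
    and t0: "t0 \<in> {a..b}" "x t0 = 0" and t: "t \<in> {a..b}"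
  shows "x t = 0"
proof -
  obtain K where K: "\<And>s. s \<in> {a..b} \<Longrightarrow> norm (A s) \<le> K"
    using compact_imp_bounded[OF compact_continuous_image[OF cont compact_Icc]]
    unfolding bounded_iff by fastforce
  define C where "C = real CARD('n) * real CARD('n) * K"
  have bound: "norm (A s *v x s) \<le> C * norm (x s)" if "s \<in> {a..b}" for s
  proof -
    have "\<bar>A s $ i $ j\<bar> \<le> K" for i j
      using component_le_norm_cart[of "A s $ i" j] Finite_Cartesian_Product.norm_nth_le[of "A s" i]
        K[OF that] by linarith
    then have "onorm ((*v) (A s)) \<le> C"
      unfolding C_def by (rule onorm_le_matrix_component)
    then show ?thesis
      using onorm[OF matrix_vector_mul_bounded_linear, of "A s" "x s"]
      by (meson mult_right_mono norm_ge_zero order_trans)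
  qed
  define N where "N s = x s \<bullet> x s" for s
  have dN: "(N has_real_derivative 2 * (x s \<bullet> (A s *v x s))) (at s)" for s
  proof -
    have "(N has_derivative (\<lambda>h. x s \<bullet> (h *\<^sub>R (A s *v x s)) + (h *\<^sub>R (A s *v x s)) \<bullet> x s)) (at s)"
      unfolding N_def using ode[of s] unfolding has_vector_derivative_def
      by (intro has_derivative_inner)
    then show ?thesis
      unfolding has_field_derivative_def
      by (rule has_derivative_eq_rhs) (simp add: fun_eq_iff inner_commute)
  qed
  have dN_le: "\<bar>2 * (x s \<bullet> (A s *v x s))\<bar> \<le> 2 * C * N s" if "s \<in> {a..b}" for s
  proof -
    have "\<bar>x s \<bullet> (A s *v x s)\<bar> \<le> norm (x s) * norm (A s *v x s)"
      by (rule Cauchy_Schwarz_ineq2)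
    also have "\<dots> \<le> norm (x s) * (C * norm (x s))"
      using bound[OF that] by (simp add: mult_left_mono)
    also have "\<dots> = C * N s"
      by (simp add: N_def dot_square_norm power2_eq_square)
    finally show ?thesis by simp
  qed
  have "N t \<le> 0"
  proof (cases "t0 \<le> t")
    case True
    have "exp (- (2 * C * t)) * N t \<le> exp (- (2 * C * t0)) * N t0"
    proof (rule DERIV_nonpos_imp_nonincreasing[OF True])
      fix s assume "t0 \<le> s" "s \<le> t"
      then have s: "s \<in> {a..b}" using t0 t by auto
      have "((\<lambda>s. exp (- (2 * C * s)) * N s) has_real_derivative
          exp (- (2 * C * s)) * (2 * (x s \<bullet> (A s *v x s)) - 2 * C * N s)) (at s)"
        by (auto intro!: derivative_eq_intros dN simp: algebra_simps)
      moreover have "exp (- (2 * C * s)) * (2 * (x s \<bullet> (A s *v x s)) - 2 * C * N s) \<le> 0"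
        using dN_le[OF s] by (intro mult_nonneg_nonpos) auto
      ultimately show "\<exists>y. ((\<lambda>s. exp (- (2 * C * s)) * N s) has_real_derivative y) (at s) \<and> y \<le> 0"
        by blast
    qed
    then show ?thesis using t0(2) by (simp add: N_def mult_le_0_iff)
  next
    case False
    then have le: "t \<le> t0" by simp
    have "exp (2 * C * t) * N t \<le> exp (2 * C * t0) * N t0"
    proof (rule DERIV_nonneg_imp_nondecreasing[OF le])
      fix s assume "t \<le> s" "s \<le> t0"
      then have s: "s \<in> {a..b}" using t0 t by auto
      have "((\<lambda>s. exp (2 * C * s) * N s) has_real_derivative
          exp (2 * C * s) * (2 * (x s \<bullet> (A s *v x s)) + 2 * C * N s)) (at s)"
        by (auto intro!: derivative_eq_intros dN simp: algebra_simps)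
      moreover have "exp (2 * C * s) * (2 * (x s \<bullet> (A s *v x s)) + 2 * C * N s) \<ge> 0"
        using dN_le[OF s] by (intro mult_nonneg_nonneg) auto
      ultimately show "\<exists>y. ((\<lambda>s. exp (2 * C * s) * N s) has_real_derivative y) (at s) \<and> y \<ge> 0"
        by blast
    qed
    then show ?thesis using t0(2) by (simp add: N_def mult_le_0_iff)
  qed
  then show ?thesis
    using inner_ge_zero[of "x t"] inner_eq_zero_iff[of "x t"] unfolding N_def by linarith
qed

lemma has_vector_derivative_matrix_vector_mult:
  fixes Y :: "real \<Rightarrow> real^'n^'m"
  assumes "(Y has_vector_derivative Y') (at s)"
  shows "((\<lambda>s. Y s *v v) has_vector_derivative (Y' *v v)) (at s)"
proof -
  have "linear (\<lambda>M::real^'n^'m. M *v v)"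
    by (rule linearI) (simp_all add: matrix_vector_mult_add_rdistrib scaleR_matrix_vector_assoc)
  then show ?thesis
    using bounded_linear.has_vector_derivative[OF _ assms] linear_conv_bounded_linear by blast
qed

text \<open>
  Applied to a vector \<open>v\<close>, the commutator of \<open>R\<close> and \<open>Y\<close> solves the same linear equation as \<open>Y\<close> does,
  with initial value \<open>0\<close>.
\<close>

lemma fundamental_matrix_commutes:
  fixes Y A :: "real \<Rightarrow> real^'n^'n" and R :: "real^'n^'n"
  assumes cont: "continuous_on {0..t} A" and "0 \<le> t"
    and ode: "\<And>s. (Y has_vector_derivative (A s ** Y s)) (at s)"
    and A: "\<And>s. R ** A s = A s ** R" and Y0: "R ** Y 0 = Y 0 ** R"
  shows "R ** Y t = Y t ** R"
proof -
  have "R *v (Y t *v v) - Y t *v (R *v v) = 0" for v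
  proof (rule linear_ode_zero[where x = "\<lambda>s. R *v (Y s *v v) - Y s *v (R *v v)", OF cont])
    show "((\<lambda>s. R *v (Y s *v v) - Y s *v (R *v v)) has_vector_derivative
        A s *v (R *v (Y s *v v) - Y s *v (R *v v))) (at s)" for s
    proof -
      have "((\<lambda>s. R *v (Y s *v v) - Y s *v (R *v v)) has_vector_derivative
          R *v ((A s ** Y s) *v v) - (A s ** Y s) *v (R *v v)) (at s)"
        by (intro has_vector_derivative_diff has_vector_derivative_matrix_vector_mult ode
            bounded_linear.has_vector_derivative[OF matrix_vector_mul_bounded_linear])
      then show ?thesis
        by (simp add: matrix_vector_mult_diff_distrib matrix_vector_mul_assoc matrix_mul_assoc A)
    qed
    show "R *v (Y 0 *v v) - Y 0 *v (R *v v) = 0"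
      by (simp add: matrix_vector_mul_assoc Y0)
  qed (use \<open>0 \<le> t\<close> in auto)
  then show ?thesis
    by (simp add: matrix_eq matrix_vector_mul_assoc)
qed

text \<open>
  A vector in the kernel of \<open>Y t\<close> yields a solution that vanishes at time \<open>t\<close>, hence also at time
  \<open>0\<close>, where \<open>Y\<close> has trivial kernel.
\<close>

lemma fundamental_matrix_invertible:
  fixes Y A :: "real \<Rightarrow> real^'n^'n"
  assumes cont: "continuous_on {0..t} A" and "0 \<le> t"
    and ode: "\<And>s. (Y has_vector_derivative (A s ** Y s)) (at s)"
    and Y0: "invertible (Y 0)"
  shows "invertible (Y t)"
proof -
  have "v = 0" if "Y t *v v = 0" for v
  proof -
    have "Y 0 *v v = 0"
    proof (rule linear_ode_zero[where x = "\<lambda>s. Y s *v v", OF cont])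
      show "((\<lambda>s. Y s *v v) has_vector_derivative A s *v (Y s *v v)) (at s)" for s
        using has_vector_derivative_matrix_vector_mult[OF ode]
        by (simp add: matrix_vector_mul_assoc)
      show "Y t *v v = 0" by fact
    qed (use \<open>0 \<le> t\<close> in auto)
    then show ?thesis
      using Y0 matrix_left_invertible_ker unfolding invertible_def by blast
  qed
  then show ?thesis
    by (simp add: invertible_left_inverse matrix_left_invertible_ker)
qed

section \<open>Indices and vectors in dimensions four and eight\<close>

lemma exhaust_8:
  fixes x :: 8
  shows "x = 1 \<or> x = 2 \<or> x = 3 \<or> x = 4 \<or> x = 5 \<or> x = 6 \<or> x = 7 \<or> x = 8"
proof (induct x)
  case (of_int z)
  then have "0 \<le> z" "z < 8" by simp_all
  then have "z = 0 \<or> z = 1 \<or> z = 2 \<or> z = 3 \<or> z = 4 \<or> z = 5 \<or> z = 6 \<or> z = 7" by arith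
  then show ?case by auto
qed

lemma forall_8: "(\<forall>i::8. P i) \<longleftrightarrow> P 1 \<and> P 2 \<and> P 3 \<and> P 4 \<and> P 5 \<and> P 6 \<and> P 7 \<and> P 8"
  by (metis exhaust_8)

lemma UNIV_8: "(UNIV :: 8 set) = {1, 2, 3, 4, 5, 6, 7, 8}"
  using exhaust_8 by auto

lemma sum_8: "sum f (UNIV :: 8 set) = f 1 + f 2 + f 3 + f 4 + f 5 + f 6 + f 7 + f 8"
  unfolding UNIV_8 by (simp add: ac_simps)

lemma vector_4 [simp]:
  "(vector [x1,x2,x3,x4] :: 'a::zero^4) $ 1 = x1"
  "(vector [x1,x2,x3,x4] :: 'a::zero^4) $ 2 = x2"
  "(vector [x1,x2,x3,x4] :: 'a::zero^4) $ 3 = x3"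
  "(vector [x1,x2,x3,x4] :: 'a::zero^4) $ 4 = x4"
  unfolding vector_def by simp_all

lemma vector_8 [simp]:
  "(vector [x1,x2,x3,x4,x5,x6,x7,x8] :: 'a::zero^8) $ 1 = x1"
  "(vector [x1,x2,x3,x4,x5,x6,x7,x8] :: 'a::zero^8) $ 2 = x2"
  "(vector [x1,x2,x3,x4,x5,x6,x7,x8] :: 'a::zero^8) $ 3 = x3"
  "(vector [x1,x2,x3,x4,x5,x6,x7,x8] :: 'a::zero^8) $ 4 = x4"
  "(vector [x1,x2,x3,x4,x5,x6,x7,x8] :: 'a::zero^8) $ 5 = x5"
  "(vector [x1,x2,x3,x4,x5,x6,x7,x8] :: 'a::zero^8) $ 6 = x6"
  "(vector [x1,x2,x3,x4,x5,x6,x7,x8] :: 'a::zero^8) $ 7 = x7"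
  "(vector [x1,x2,x3,x4,x5,x6,x7,x8] :: 'a::zero^8) $ 8 = x8"
  unfolding vector_def by simp_all

section \<open>The reflection symmetry of the regularized Hamiltonian\<close>

definition reflection_signs :: "real^8" where
  "reflection_signs = vector [1, -1, -1, 1, 1, -1, -1, 1]"

definition reflection :: "real^8^8" where
  "reflection = diag_mat reflection_signs"

lemma reflection_signs_simps [simp]:
  "reflection_signs $ 1 = 1" "reflection_signs $ 2 = -1" "reflection_signs $ 3 = -1"
  "reflection_signs $ 4 = 1" "reflection_signs $ 5 = 1" "reflection_signs $ 6 = -1"
  "reflection_signs $ 7 = -1" "reflection_signs $ 8 = 1"
  by (simp_all add: reflection_signs_def)

lemma reflection_Smat: "reflection ** Smat = Smat ** reflection"
  by (simp add: vec_eq_iff reflection_def Smat_def)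
     (simp add: diag_mat_def)

lemma reflection_Jmat: "reflection ** Jmat = Jmat ** reflection"
proof -
  have "\<forall>i j. Jmat $ i $ j = 0 \<or> reflection_signs $ i = reflection_signs $ j"
    by (simp add: forall_8 Jmat_def)
  then show ?thesis unfolding reflection_def by (intro commute_diag_matI) blast
qed

text \<open>
  In matrix terms, \<open>Y0\<close> is a signed permutation matrix, and the permutation maps the set
  \<open>{1,4,5,8}\<close> of indices with sign \<open>1\<close> to itself. So \<open>R\<close> has the same diagonal form in the basis \<open>Y0\<close>
  as in the standard basis.
\<close>

lemma reflection_Y0mat: "reflection ** Y0mat = Y0mat ** reflection"
proof -
  have "\<forall>i j. Y0mat $ i $ j = 0 \<or> reflection_signs $ i = reflection_signs $ j"
    by (simp add: forall_8 Y0mat_def transpose_def axis_def)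
  then show ?thesis unfolding reflection_def by (intro commute_diag_matI) blast
qed

lemma invertible_Y0mat: "invertible Y0mat"
proof -
  have "transpose Y0mat ** Y0mat = mat 1"
    by (simp add: vec_eq_iff forall_8 matrix_matrix_mult_def sum_8 Y0mat_def transpose_def
        axis_def mat_def)
  then show ?thesis using invertible_left_inverse by blast
qed

lemma reflection_radicands:
  "radicand_plus m1 m2 (reflection *v z) = radicand_minus m1 m2 z"
  "radicand_minus m1 m2 (reflection *v z) = radicand_plus m1 m2 z"
  by (simp_all add: reflection_def radicand_plus_def radicand_minus_def boldQ_def algebra_simps)

lemma reflection_Gam: "Gam m1 m2 E (reflection *v z) = Gam m1 m2 E z"
  unfolding Gam_def reflection_radicands by (simp add: reflection_def)

lemma reflection_Gam_domain: "z \<in> Gam_domain m1 m2 \<Longrightarrow> reflection *v z \<in> Gam_domain m1 m2"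
  by (simp add: Gam_domain_def reflection_radicands)

lemma open_Gam_domain: "open (Gam_domain m1 m2)"
  unfolding Gam_domain_def Collect_conj_eq radicand_plus_def radicand_minus_def boldQ_def
  by (intro open_Int open_Collect_less continuous_intros)

lemma elementary_on_Gam: "elementary_on (Gam_domain m1 m2) (Gam m1 m2 E)"
proof -
  have "Gam m1 m2 E = (\<lambda>z.
     ((z$5)^2 + (z$6)^2) * (1 / (4 * m1))
     + ((z$7)^2 + (z$8)^2) * ((z$1)^2 + (z$2)^2) * (1 / m1 + 2 / m2)
     - m1 * m2 * ((z$1)^2 + (z$2)^2) * inverse (sqrt (radicand_plus m1 m2 z))
     - m1 * m2 * ((z$1)^2 + (z$2)^2) * inverse (sqrt (radicand_minus m1 m2 z))
     - m1^2 - E * ((z$1)^2 + (z$2)^2))"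
    by (rule ext) (simp only: Gam_def divide_inverse mult_1_left)
  moreover have "elementary_on (Gam_domain m1 m2) (radicand_plus m1 m2)"
    "elementary_on (Gam_domain m1 m2) (radicand_minus m1 m2)"
    unfolding radicand_plus_def[abs_def] radicand_minus_def[abs_def] boldQ_def
    by (intro elementary_on.const elementary_on.coord elementary_on.add elementary_on.mult
        elementary_on_power elementary_on_diff)+
  then have "elementary_on (Gam_domain m1 m2) (\<lambda>z. inverse (sqrt (radicand_plus m1 m2 z)))"
    "elementary_on (Gam_domain m1 m2) (\<lambda>z. inverse (sqrt (radicand_minus m1 m2 z)))"
    by (auto intro!: elementary_on.inverse_sqrt simp: Gam_domain_def)
  ultimately show ?thesis
    by (simp only:)
       (intro elementary_on_diff elementary_on.const elementary_on.coord elementary_on.add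
        elementary_on.mult elementary_on_power; assumption)
qed

lemma reflection_hessian_Gam:
  assumes "z \<in> Gam_domain m1 m2" "reflection *v z = z"
  shows "reflection ** hessian (Gam m1 m2 E) z = hessian (Gam m1 m2 E) z ** reflection"
proof -
  have "\<forall>i. reflection_signs $ i * reflection_signs $ i = 1"
    by (simp add: forall_8)
  then show ?thesis
    unfolding reflection_def
    using assms reflection_Gam reflection_Gam_domain
    by (intro hessian_commutes_with_symmetry[OF open_Gam_domain elementary_on_Gam])
       (auto simp: reflection_def)
qed

section \<open>The block K\<close>

lemma commutes_matrix_inv:
  fixes A R :: "real^'n^'n"
  assumes "invertible A" and "R ** A = A ** R"
  shows "R ** matrix_inv A = matrix_inv A ** R"
proof -
  have inv: "A ** matrix_inv A = mat 1" "matrix_inv A ** A = mat 1"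
    using someI_ex[OF assms(1)[unfolded invertible_def]] unfolding matrix_inv_def by blast+
  then have "R ** matrix_inv A = matrix_inv A ** A ** R ** matrix_inv A"
    by simp
  also have "\<dots> = matrix_inv A ** R ** (A ** matrix_inv A)"
    using assms(2) by (metis matrix_mul_assoc)
  finally show ?thesis by (simp add: inv)
qed

lemma commutes_mult:
  fixes A B R :: "real^'n^'n"
  assumes "R ** A = A ** R" "R ** B = B ** R"
  shows "R ** (A ** B) = (A ** B) ** R"
  using assms by (metis matrix_mul_assoc)

lemma reflection_Wmat:
  assumes "invertible B" "reflection ** B = B ** reflection"
  shows "reflection ** Wmat B = Wmat B ** reflection"
  unfolding Wmat_def
  by (intro commutes_mult commutes_matrix_inv reflection_Smat reflection_Y0mat
      invertible_Y0mat assms)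

text \<open>
  Rows and columns \<open>5, 6, 7, 8\<close> carry the signs \<open>1, -1, -1, 1\<close>; the entries that \<open>Mset\<close> requires to
  vanish are the positions where the row sign differs from the column sign.
\<close>

lemma Kmat_in_Mset:
  assumes "reflection ** Wmat B = Wmat B ** reflection"
  shows "Kmat B \<in> Mset"
  using commute_diag_mat_imp_zero[OF assms[unfolded reflection_def]]
  by (simp add: Mset_def Kmat_def lower_right_block_def)

theorem theorem3p9:
  fixes m1 m2 E T :: real
    and \<gamma> :: "real \<Rightarrow> real^8"
    and Y :: "real \<Rightarrow> real^8^8"
  assumes "m1 > 0" and "m2 > 0" and "2 * m1 + m2 = 3" and "E < 0"
    and "broucke_orbit m1 m2 E T \<gamma>"
    and "linearized_solution m1 m2 E \<gamma> Y"
  shows "Kmat (Y (T/4)) \<in> Mset"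
proof -
  let ?A = "\<lambda>s. Jmat ** hessian (Gam m1 m2 E) (\<gamma> s)"
  have "0 \<le> T/4"
    using assms(5) unfolding broucke_orbit_def by linarith
  have dom: "\<gamma> s \<in> Gam_domain m1 m2"
    and d\<gamma>: "(\<gamma> has_vector_derivative (Jmat *v gradient (Gam m1 m2 E) (\<gamma> s))) (at s)"
    and zero: "\<gamma> s $ 2 = 0" "\<gamma> s $ 3 = 0" "\<gamma> s $ 6 = 0" "\<gamma> s $ 7 = 0" for s
    using assms(5) unfolding broucke_orbit_def Gam_solution_def by blast+
  have Y0: "Y 0 = Y0mat"
    and ode: "(Y has_vector_derivative (?A s ** Y s)) (at s)" for s
    using assms(6) unfolding linearized_solution_def by blast+
  have "continuous_on UNIV \<gamma>"
    using d\<gamma> has_vector_derivative_continuous continuous_at_imp_continuous_on by blast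
  then have "continuous_on {0..T/4} (\<lambda>s. hessian (Gam m1 m2 E) (\<gamma> s))"
    using dom
    by (intro continuous_on_compose2[OF elementary_on_imp_C2(3)[OF open_Gam_domain elementary_on_Gam]])
       (auto elim: continuous_on_subset)
  then have cont: "continuous_on {0..T/4} ?A"
    unfolding matrix_matrix_mult_def by (intro continuous_intros)
  have "reflection *v \<gamma> s = \<gamma> s" for s
    using zero[of s] by (simp add: vec_eq_iff forall_8 reflection_def)
  then have A: "reflection ** ?A s = ?A s ** reflection" for s
    by (intro commutes_mult reflection_Jmat reflection_hessian_Gam dom)
  have "reflection ** Y (T/4) = Y (T/4) ** reflection"
    using fundamental_matrix_commutes[OF cont \<open>0 \<le> T/4\<close> ode A] Y0 reflection_Y0mat by simp
  moreover have "invertible (Y (T/4))"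
    using fundamental_matrix_invertible[OF cont \<open>0 \<le> T/4\<close> ode] Y0 invertible_Y0mat by simp
  ultimately show ?thesis
    by (intro Kmat_in_Mset reflection_Wmat)
qed

end
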